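(* For $n\in\mathbb N$ with $n\ge3$ there are exactly $2n-4$ one-generated arrow-closed $(1\times1)$-subcontexts of the standard context $\mathbb K(\mathcal L_n)=(\mathcal J(\mathcal L_n),\mathcal M(\mathcal L_n),\le)$.
   Context: A partition of $n\in\mathbb N=\{0,1,2,\dots\}$ is a tuple $(a_1,\dots,a_n)$ of natural numbers with $a_1\ge\dots\ge a_n\ge 0$ and $\sum a_i=n$. $\mathcal L_n$ is the finite lattice of all partitions of $n$ under the dominance order: $a\le b$ iff $\sum_{i=1}^j a_i\le\sum_{i=1}^j b_i$ for all $1\le j\le n$. $\mathcal J(\mathcal L_n)$ is the set of (completely) join-irreducible elements (not the least element, and $x=y\vee z$ implies $x=y$ or $x=z$); $\mathcal M(\mathcal L_n)$ is the set of (completely) meet-irreducible elements (not the greatest element, and $x=y\wedge z$ implies $x=y$ or $x=z$). Arrow relations of $\mathbb K(\mathcal L_n)$: for $g\in\mathcal J(\mathcal L_n)$ and $m\in\mathcal M(\mathcal L_n)$ put $g'=\{y\in\mathcal M(\mathcal L_n): g\le y\}$ and $m'=\{y\in\mathcal J(\mathcal L_n): y\le m\}$. Then $g\swarrow m$ iff $g\nleq m$ and for all $h\in\mathcal J(\mathcal L_n)$ with $g'\subsetneq h'$ we have $h\le m$; and $g\nearrow m$ iff $g\nleq m$ and for all $y\in\mathcal M(\mathcal L_n)$ with $m'\subsetneq y'$ we have $g\le y$. A subcontext of $\mathbb K(\mathcal L_n)$ is a triple $(H,N,{\le}\cap(H\times N))$ with $H\subseteq\mathcal J(\mathcal L_n)$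 (objects) and $N\subseteq\mathcal M(\mathcal L_n)$ (attributes). It is arrow-closed if for all $h\in H$ and $m\in\mathcal M(\mathcal L_n)$, $h\nearrow m$ implies $m\in N$, and for all $n'\in N$ and $g\in\mathcal J(\mathcal L_n)$, $g\swarrow n'$ implies $g\in H$. For any sets $G_1$ of objects and $M_1$ of attributes there is a smallest arrow-closed subcontext with $G_1\subseteq H$, $M_1\subseteq N$. It is one-generated if it is the smallest arrow-closed subcontext for $G_1=\{g\}$, $M_1=\emptyset$ with a single object $g$ (or dually for $G_1=\emptyset$, $M_1=\{m\}$ with a single attribute $m$). It is a $(1\times1)$-subcontext if $|H|=|N|=1$. Subcontexts are counted as distinct when the pairs $(H,N)$ are distinct. *)

theory Defs
  imports "HOL-Algebra.Lattice"
begin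

section \<open>The lattice of partitions of n under dominance\<close>

text \<open>Partitions of \<open>n\<close> are padded with zeros to length exactly \<open>n\<close>.\<close>

definition partitions_of :: "nat \<Rightarrow> nat list set" where
  "partitions_of n = {a. length a = n \<and> sorted_wrt (\<ge>) a \<and> sum_list a = n}"

definition dominated :: "nat \<Rightarrow> nat list \<Rightarrow> nat list \<Rightarrow> bool" where
  "dominated n a b \<longleftrightarrow> (\<forall>j\<in>{1..n}. (\<Sum>i<j. a ! i) \<le> (\<Sum>i<j. b ! i))"

definition partition_lattice :: "nat \<Rightarrow> nat list gorder" where
  "partition_lattice n = \<lparr>carrier = partitions_of n, eq = (=), le = dominated n\<rparr>"

section \<open>Join- and meet-irreducible elements\<close>

definition join_irreducibles :: "('a, 'b) gorder_scheme \<Rightarrow> 'a set" where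
  "join_irreducibles L = {x \<in> carrier L. \<not> least L x (carrier L) \<and>
     (\<forall>y\<in>carrier L. \<forall>z\<in>carrier L. x = y \<squnion>\<^bsub>L\<^esub> z \<longrightarrow> x = y \<or> x = z)}"

definition meet_irreducibles :: "('a, 'b) gorder_scheme \<Rightarrow> 'a set" where
  "meet_irreducibles L = {x \<in> carrier L. \<not> greatest L x (carrier L) \<and>
     (\<forall>y\<in>carrier L. \<forall>z\<in>carrier L. x = y \<sqinter>\<^bsub>L\<^esub> z \<longrightarrow> x = y \<or> x = z)}"

section \<open>The standard context and its arrow relations\<close>

definition object_deriv :: "('a, 'b) gorder_scheme \<Rightarrow> 'a \<Rightarrow> 'a set" where
  "object_deriv L g = {y \<in> meet_irreducibles L. g \<sqsubseteq>\<^bsub>L\<^esub> y}"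

definition attribute_deriv :: "('a, 'b) gorder_scheme \<Rightarrow> 'a \<Rightarrow> 'a set" where
  "attribute_deriv L m = {y \<in> join_irreducibles L. y \<sqsubseteq>\<^bsub>L\<^esub> m}"

text \<open>The arrows \<open>g \<swarrow> m\<close> and \<open>g \<nearrow> m\<close>, for
  \<open>g \<in> join_irreducibles L\<close> and \<open>m \<in> meet_irreducibles L\<close>.\<close>

definition down_arrow :: "('a, 'b) gorder_scheme \<Rightarrow> 'a \<Rightarrow> 'a \<Rightarrow> bool" where
  "down_arrow L g m \<longleftrightarrow> \<not> g \<sqsubseteq>\<^bsub>L\<^esub> m \<and>
     (\<forall>h\<in>join_irreducibles L. object_deriv L g \<subset> object_deriv L h \<longrightarrow> h \<sqsubseteq>\<^bsub>L\<^esub> m)"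

definition up_arrow :: "('a, 'b) gorder_scheme \<Rightarrow> 'a \<Rightarrow> 'a \<Rightarrow> bool" where
  "up_arrow L g m \<longleftrightarrow> \<not> g \<sqsubseteq>\<^bsub>L\<^esub> m \<and>
     (\<forall>y\<in>meet_irreducibles L. attribute_deriv L m \<subset> attribute_deriv L y \<longrightarrow> g \<sqsubseteq>\<^bsub>L\<^esub> y)"

section \<open>Arrow-closed subcontexts\<close>

text \<open>A subcontext carries the restricted order as incidence relation, so it is
  represented by the pair of its object set and its attribute set alone.\<close>

definition subcontext :: "('a, 'b) gorder_scheme \<Rightarrow> 'a set \<times> 'a set \<Rightarrow> bool" where
  "subcontext L = (\<lambda>(H, N). H \<subseteq> join_irreducibles L \<and> N \<subseteq> meet_irreducibles L)"

definition arrow_closed :: "('a, 'b) gorder_scheme \<Rightarrow> 'a set \<times> 'a set \<Rightarrow> bool" where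
  "arrow_closed L = (\<lambda>(H, N). subcontext L (H, N) \<and>
     (\<forall>h\<in>H. \<forall>m\<in>meet_irreducibles L. up_arrow L h m \<longrightarrow> m \<in> N) \<and>
     (\<forall>m\<in>N. \<forall>g\<in>join_irreducibles L. down_arrow L g m \<longrightarrow> g \<in> H))"

definition arrow_closed_containing ::
  "('a, 'b) gorder_scheme \<Rightarrow> 'a set \<Rightarrow> 'a set \<Rightarrow> 'a set \<times> 'a set \<Rightarrow> bool" where
  "arrow_closed_containing L G1 M1 S \<longleftrightarrow>
     arrow_closed L S \<and> G1 \<subseteq> fst S \<and> M1 \<subseteq> snd S"

definition smallest_arrow_closed ::
  "('a, 'b) gorder_scheme \<Rightarrow> 'a set \<Rightarrow> 'a set \<Rightarrow> 'a set \<times> 'a set \<Rightarrow> bool" where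
  "smallest_arrow_closed L G1 M1 S \<longleftrightarrow>
     arrow_closed_containing L G1 M1 S \<and>
     (\<forall>T. arrow_closed_containing L G1 M1 T \<longrightarrow> fst S \<subseteq> fst T \<and> snd S \<subseteq> snd T)"

definition one_generated :: "('a, 'b) gorder_scheme \<Rightarrow> 'a set \<times> 'a set \<Rightarrow> bool" where
  "one_generated L S \<longleftrightarrow>
     (\<exists>g\<in>join_irreducibles L. smallest_arrow_closed L {g} {} S) \<or>
     (\<exists>m\<in>meet_irreducibles L. smallest_arrow_closed L {} {m} S)"

definition one_by_one :: "'a set \<times> 'a set \<Rightarrow> bool" where
  "one_by_one S \<longleftrightarrow> card (fst S) = 1 \<and> card (snd S) = 1"

end

(* In a finite lattice, {g} and {m} form an arrow-closed subcontext iff the lattice is the disjoint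
   union of the principal filter of g and the principal ideal of m (a prime pair), so prime pairs
   have to be counted. For a hook H_a = (a, 1, ..., 1), x >= H_a iff the first part of x is at
   least a, and x <= H_b iff x has more than n - b nonzero parts; this gives one prime pair (H_a, m)
   for each 2 <= a <= n and one (g, H_b) for each 1 <= b <= n - 1. There are no others, and
   exactly two are of both kinds: (H_2, H_1) and (H_n, H_(n-1)). *)

theory Submission
  imports Defs "HOL-Algebra.Complete_Lattice"
begin

section \<open>Prime pairs\<close>

text \<open>The condition is self-dual, so each fact about \<open>g\<close> yields one about
  \<open>m\<close> by reversing the order. In a finite lattice it forces both elements to be
  irreducible.\<close>

definition prime_pair :: "('a, 'b) gorder_scheme \<Rightarrow> 'a \<Rightarrow> 'a \<Rightarrow> bool" where
  "prime_pair L g m \<longleftrightarrow> g \<in> carrier L \<and> m \<in> carrier L \<and>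
     (\<forall>x\<in>carrier L. g \<sqsubseteq>\<^bsub>L\<^esub> x \<longleftrightarrow> \<not> x \<sqsubseteq>\<^bsub>L\<^esub> m)"

section \<open>Order duality of irreducibles, arrows and prime pairs\<close>

lemma join_irreducibles_inv_gorder [simp]:
  "join_irreducibles (inv_gorder L) = meet_irreducibles L"
  by (simp add: join_irreducibles_def meet_irreducibles_def)

lemma meet_irreducibles_inv_gorder [simp]:
  "meet_irreducibles (inv_gorder L) = join_irreducibles L"
  by (simp add: join_irreducibles_def meet_irreducibles_def)

lemma down_arrow_inv_gorder [simp]: "down_arrow (inv_gorder L) m g \<longleftrightarrow> up_arrow L g m"
  by (simp add: up_arrow_def down_arrow_def attribute_deriv_def object_deriv_def)

lemma prime_pair_inv_gorder [simp]: "prime_pair (inv_gorder L) m g \<longleftrightarrow> prime_pair L g m"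
  by (auto simp: prime_pair_def)

locale finite_complete_lattice = complete_lattice +
  assumes finite_carrier: "finite (carrier L)"
begin

lemma dual_finite_complete_lattice: "finite_complete_lattice (inv_gorder L)"
proof -
  interpret dual: weak_complete_lattice "inv_gorder L"
    by (rule dual_weak_complete_lattice)
  show ?thesis
    by unfold_locales
      (use dual.sup_exists dual.inf_exists finite_carrier eq_is_equal in auto)
qed

section \<open>Irreducibles and arrows in finite lattices\<close>

lemma ex_minimal:
  assumes "x \<in> carrier L" "P x"
  obtains m where "m \<in> carrier L" "P m" "m \<sqsubseteq> x"
    "\<And>y. y \<in> carrier L \<Longrightarrow> P y \<Longrightarrow> y \<sqsubseteq> m \<Longrightarrow> y = m"
proof -
  let ?A = "{y \<in> carrier L. P y \<and> y \<sqsubseteq> x}"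
  let ?R = "\<lambda>y z. y \<sqsubseteq> z \<and> y \<noteq> z"
  have "\<exists>m\<in>?A. \<forall>y\<in>?A. y \<noteq> m \<longrightarrow> \<not> ?R y m"
  proof (rule Finite_Set.bex_min_element)
    show "finite ?A" using finite_carrier by simp
    show "asymp_on ?A ?R" by (auto intro!: asymp_onI dest: le_antisym)
    show "transp_on ?A ?R" by (rule transp_onI) (blast dest: le_antisym intro: le_trans)
    show "?A \<noteq> {}" using assms by auto
  qed
  then obtain m where "m \<in> ?A" "\<And>y. y \<in> ?A \<Longrightarrow> y \<sqsubseteq> m \<Longrightarrow> y = m" by blast
  with that assms show thesis by (smt (verit) le_trans mem_Collect_eq)
qed

text \<open>A minimal element \<open>j\<close> among those not below \<open>y\<close> is
  join-irreducible: if \<open>j\<close> were the join of two elements different from it, minimality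
  would put both, and hence \<open>j\<close>, below \<open>y\<close>.\<close>

lemma join_irreducible_separates:
  assumes x: "x \<in> carrier L" and y: "y \<in> carrier L" and "\<not> x \<sqsubseteq> y"
  obtains j where "j \<in> join_irreducibles L" "j \<sqsubseteq> x" "\<not> j \<sqsubseteq> y"
proof -
  obtain j where j: "j \<in> carrier L" "\<not> j \<sqsubseteq> y" "j \<sqsubseteq> x"
    and min: "\<And>z. z \<in> carrier L \<Longrightarrow> \<not> z \<sqsubseteq> y \<Longrightarrow> z \<sqsubseteq> j \<Longrightarrow> z = j"
    using ex_minimal[of x "\<lambda>z. \<not> z \<sqsubseteq> y"] assms by metis
  have "j = a \<or> j = b" if ab: "a \<in> carrier L" "b \<in> carrier L" "j = a \<squnion> b" for a b
  proof (rule ccontr)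
    assume neq: "\<not> (j = a \<or> j = b)"
    have "a \<sqsubseteq> j" "b \<sqsubseteq> j" using ab join_left join_right by auto
    then have "a \<sqsubseteq> y" "b \<sqsubseteq> y" using min ab neq by metis+
    then have "a \<squnion> b \<sqsubseteq> y" using ab y by (simp add: join_le)
    with ab j show False by simp
  qed
  moreover have "\<not> least L j (carrier L)"
    using j y by (auto simp: least_def)
  ultimately have "j \<in> join_irreducibles L"
    using j by (auto simp: join_irreducibles_def)
  with j that show thesis by blast
qed

text \<open>Together with its dual, this turns the strict inclusions of derivations in the arrow
  relations into strict inequalities.\<close>

lemma le_if_attribute_deriv_subset:
  assumes "x \<in> carrier L" "y \<in> carrier L" "attribute_deriv L x \<subseteq> attribute_deriv L y"
  shows "x \<sqsubseteq> y"
proof (rule ccontr)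
  assume "\<not> x \<sqsubseteq> y"
  then obtain j where "j \<in> join_irreducibles L" "j \<sqsubseteq> x" "\<not> j \<sqsubseteq> y"
    using assms join_irreducible_separates by metis
  then show False using assms(3) by (auto simp: attribute_deriv_def)
qed

lemma join_irreducible_carrier: "g \<in> join_irreducibles L \<Longrightarrow> g \<in> carrier L"
  by (simp add: join_irreducibles_def)

lemma meet_irreducible_carrier: "m \<in> meet_irreducibles L \<Longrightarrow> m \<in> carrier L"
  by (simp add: meet_irreducibles_def)

text \<open>A minimal element outside the ideal of \<open>m\<close> is join-irreducible, and
  whatever lies strictly below it lies below \<open>m\<close>, which is what the arrow
  requires.\<close>

lemma down_arrow_exists:
  assumes x: "x \<in> carrier L" and m: "m \<in> carrier L" and "\<not> x \<sqsubseteq> m"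
  obtains g where "g \<in> join_irreducibles L" "g \<sqsubseteq> x" "down_arrow L g m"
proof -
  interpret dual: finite_complete_lattice "inv_gorder L"
    by (rule dual_finite_complete_lattice)
  obtain j where j: "j \<in> carrier L" "\<not> j \<sqsubseteq> m" "j \<sqsubseteq> x"
    and min: "\<And>z. z \<in> carrier L \<Longrightarrow> \<not> z \<sqsubseteq> m \<Longrightarrow> z \<sqsubseteq> j \<Longrightarrow> z = j"
    using ex_minimal[of x "\<lambda>z. \<not> z \<sqsubseteq> m"] assms by metis
  obtain g where g: "g \<in> join_irreducibles L" "g \<sqsubseteq> j" "\<not> g \<sqsubseteq> m"
    using join_irreducible_separates[OF j(1) m j(2)] by blast
  then have [simp]: "g = j"
    using min[of g] join_irreducible_carrier by simp
  have "h \<sqsubseteq> m" if h: "h \<in> join_irreducibles L" "object_deriv L j \<subset> object_deriv L h" for h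
  proof -
    \<comment> \<open>In the reversed order object derivations become attribute derivations, so a
      larger object derivation means a smaller element.\<close>
    have "h \<sqsubseteq> j"
      using dual.le_if_attribute_deriv_subset[of j h] h j
      by (auto simp: attribute_deriv_def object_deriv_def join_irreducible_carrier)
    moreover have "h \<noteq> j" using h by auto
    ultimately show ?thesis using min[of h] h join_irreducible_carrier by auto
  qed
  then have "down_arrow L j m" using j by (simp add: down_arrow_def)
  with g j that show thesis by simp
qed

text \<open>If \<open>g\<close> is the join of \<open>a\<close> and \<open>b\<close>, they cannot
  both lie below \<open>m\<close>, so one of them lies above \<open>g\<close> and equals it.\<close>

lemma prime_pair_join_irreducible:
  assumes "prime_pair L g m"
  shows "g \<in> join_irreducibles L"
proof -
  have g: "g \<in> carrier L" and m: "m \<in> carrier L"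
    and gm: "\<And>x. x \<in> carrier L \<Longrightarrow> g \<sqsubseteq> x \<longleftrightarrow> \<not> x \<sqsubseteq> m"
    using assms by (auto simp: prime_pair_def)
  have "\<not> g \<sqsubseteq> m" using gm m by auto
  moreover have "g = a \<or> g = b" if ab: "a \<in> carrier L" "b \<in> carrier L" "g = a \<squnion> b" for a b
  proof -
    have "\<not> (a \<sqsubseteq> m \<and> b \<sqsubseteq> m)"
      using ab m join_le \<open>\<not> g \<sqsubseteq> m\<close> by auto
    then have "g \<sqsubseteq> a \<or> g \<sqsubseteq> b" using gm ab by auto
    moreover have "a \<sqsubseteq> g" "b \<sqsubseteq> g" using ab join_left join_right by auto
    ultimately show ?thesis using ab g le_antisym by blast
  qed
  ultimately show ?thesis
    using g m by (auto simp: join_irreducibles_def least_def)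
qed

text \<open>\<open>g\<close> is the least element outside the ideal of \<open>m\<close>, while an
  arrow from \<open>h\<close> to \<open>m\<close> makes \<open>h\<close> minimal among the
  join-irreducibles outside that ideal.\<close>

lemma prime_pair_down_arrow_iff:
  assumes pp: "prime_pair L g m" and h: "h \<in> join_irreducibles L"
  shows "down_arrow L h m \<longleftrightarrow> h = g"
proof -
  interpret dual: finite_complete_lattice "inv_gorder L"
    by (rule dual_finite_complete_lattice)
  have g: "g \<in> carrier L" and m: "m \<in> carrier L"
    and gm: "\<And>x. x \<in> carrier L \<Longrightarrow> g \<sqsubseteq> x \<longleftrightarrow> \<not> x \<sqsubseteq> m"
    using pp by (auto simp: prime_pair_def)
  have ngm: "\<not> g \<sqsubseteq> m" using gm m by auto
  have mono: "y \<sqsubseteq> x" if "object_deriv L x \<subseteq> object_deriv L y" "x \<in> carrier L" "y \<in> carrier L" for x y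
    using dual.le_if_attribute_deriv_subset[of x y] that
    by (auto simp: attribute_deriv_def object_deriv_def)
  have anti: "object_deriv L x \<subseteq> object_deriv L y" if "y \<sqsubseteq> x" "x \<in> carrier L" "y \<in> carrier L" for x y
    using that le_trans meet_irreducible_carrier by (fastforce simp: object_deriv_def)
  have gJ: "g \<in> join_irreducibles L" using pp by (rule prime_pair_join_irreducible)
  note hc = join_irreducible_carrier[OF h]
  show ?thesis
  proof
    assume d: "down_arrow L h m"
    then have le: "g \<sqsubseteq> h" using gm hc by (auto simp: down_arrow_def)
    show "h = g"
    proof (rule ccontr)
      assume "h \<noteq> g"
      then have "\<not> h \<sqsubseteq> g" using le hc g le_antisym by blast
      then have "object_deriv L h \<subset> object_deriv L g"
        using anti[OF le] mono hc g by blast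
      then show False using d gJ ngm by (auto simp: down_arrow_def)
    qed
  next
    assume [simp]: "h = g"
    have "k \<sqsubseteq> m" if k: "k \<in> join_irreducibles L" "object_deriv L g \<subset> object_deriv L k" for k
    proof (rule ccontr)
      assume "\<not> k \<sqsubseteq> m"
      then have "g \<sqsubseteq> k" using gm k join_irreducible_carrier by simp
      then have "object_deriv L k \<subseteq> object_deriv L g"
        using anti[of g k] k g join_irreducible_carrier by simp
      with k show False by auto
    qed
    then show "down_arrow L h m" using ngm by (simp add: down_arrow_def)
  qed
qed

lemma prime_pair_meet_irreducible:
  assumes "prime_pair L g m"
  shows "m \<in> meet_irreducibles L"
  using finite_complete_lattice.prime_pair_join_irreducible[OF dual_finite_complete_lattice, of m g]
    assms by simp

lemma prime_pair_up_arrow_iff: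
  assumes "prime_pair L g m" "k \<in> meet_irreducibles L"
  shows "up_arrow L g k \<longleftrightarrow> k = m"
  using finite_complete_lattice.prime_pair_down_arrow_iff[OF dual_finite_complete_lattice, of m g k]
    assms by simp

text \<open>Below every element outside the ideal of \<open>m\<close> some join-irreducible has a
  down arrow to \<open>m\<close>. Closedness forces it to be \<open>g\<close>, so \<open>g\<close>
  is below all these elements.\<close>

lemma prime_pair_if_arrow_closed:
  assumes "arrow_closed L ({g}, {m})"
  shows "prime_pair L g m"
proof -
  have gJ: "g \<in> join_irreducibles L" and mM: "m \<in> meet_irreducibles L"
    and dn: "\<And>h. h \<in> join_irreducibles L \<Longrightarrow> down_arrow L h m \<Longrightarrow> h = g"
    using assms unfolding arrow_closed_def subcontext_def by simp_all
  note g = join_irreducible_carrier[OF gJ] and m = meet_irreducible_carrier[OF mM]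
  have le: "g \<sqsubseteq> x" if "x \<in> carrier L" "\<not> x \<sqsubseteq> m" for x
    by (rule down_arrow_exists[OF that(1) m that(2)]) (use dn in blast)
  \<comment> \<open>\<open>m\<close> is not the greatest element, so the ideal of \<open>m\<close>
    has a nonempty complement. This yields an actual arrow from \<open>g\<close> to \<open>m\<close>
    and hence that \<open>g\<close> is not below \<open>m\<close>.\<close>
  obtain t where t: "t \<in> carrier L" "\<not> t \<sqsubseteq> m"
    using mM unfolding meet_irreducibles_def greatest_def by blast
  have "down_arrow L g m"
    by (rule down_arrow_exists[OF t(1) m t(2)]) (use dn in blast)
  then have "\<not> g \<sqsubseteq> m" by (simp add: down_arrow_def)
  then show ?thesis
    using le g m le_trans[of g _ m] unfolding prime_pair_def by blast
qed

lemma arrow_closed_if_prime_pair: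
  assumes "prime_pair L g m"
  shows "arrow_closed L ({g}, {m})"
  using prime_pair_join_irreducible[OF assms] prime_pair_meet_irreducible[OF assms]
    prime_pair_down_arrow_iff[OF assms] prime_pair_up_arrow_iff[OF assms]
  by (auto simp: arrow_closed_def subcontext_def)

text \<open>The up arrow from \<open>g\<close> to \<open>m\<close> forces \<open>m\<close> into
  every arrow-closed subcontext that contains \<open>g\<close>.\<close>

lemma one_generated_if_prime_pair:
  assumes pp: "prime_pair L g m"
  shows "one_generated L ({g}, {m})"
proof -
  note gJ = prime_pair_join_irreducible[OF pp] and mM = prime_pair_meet_irreducible[OF pp]
  have "up_arrow L g m" using prime_pair_up_arrow_iff[OF pp mM] by simp
  then have "\<forall>H N. arrow_closed L (H, N) \<and> g \<in> H \<longrightarrow> m \<in> N"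
    using mM unfolding arrow_closed_def by blast
  then have "smallest_arrow_closed L {g} {} ({g}, {m})"
    using arrow_closed_if_prime_pair[OF pp]
    by (simp add: smallest_arrow_closed_def arrow_closed_containing_def)
  then show ?thesis using gJ unfolding one_generated_def by blast
qed

lemma one_generated_one_by_one_eq:
  "{S. one_generated L S \<and> one_by_one S} = (\<lambda>(g, m). ({g}, {m})) ` {(g, m). prime_pair L g m}"
proof (intro equalityI subsetI)
  fix S assume "S \<in> {S. one_generated L S \<and> one_by_one S}"
  then have "arrow_closed L S" "one_by_one S"
    by (auto simp: one_generated_def smallest_arrow_closed_def arrow_closed_containing_def)
  moreover from this obtain g m where "S = ({g}, {m})"
    by (metis card_1_singletonE one_by_one_def prod.collapse)
  ultimately show "S \<in> (\<lambda>(g, m). ({g}, {m})) ` {(g, m). prime_pair L g m}"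
    using prime_pair_if_arrow_closed by auto
qed (auto simp: one_by_one_def intro: one_generated_if_prime_pair)

lemma card_one_generated_one_by_one:
  "card {S. one_generated L S \<and> one_by_one S} = card {(g, m). prime_pair L g m}"
  unfolding one_generated_one_by_one_eq by (rule card_image) (auto simp: inj_on_def)

end

section \<open>Partial sums of partitions\<close>

text \<open>Dominance is the pointwise order on these sums, and partitions correspond to monotone
  concave sequences from 0 to \<open>n\<close>.\<close>

definition psum :: "nat list \<Rightarrow> nat \<Rightarrow> nat" where
  "psum a j = (\<Sum>i<j. a ! i)"

lemma psum_0 [simp]: "psum a 0 = 0"
  by (simp add: psum_def)

lemma psum_Suc [simp]: "psum a (Suc j) = psum a j + a ! j"
  by (simp add: psum_def)

lemma psum_mono: "i \<le> j \<Longrightarrow> psum a i \<le> psum a j"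
  unfolding psum_def by (rule sum_mono2) auto

lemma dominated_iff_psum: "dominated n a b \<longleftrightarrow> (\<forall>j\<le>n. psum a j \<le> psum b j)"
proof -
  have "{..n} = insert 0 {1..n}" by auto
  then have "(\<forall>j\<le>n. psum a j \<le> psum b j) \<longleftrightarrow> (\<forall>j\<in>insert 0 {1..n}. psum a j \<le> psum b j)"
    by (metis atMost_iff)
  then show ?thesis by (simp add: dominated_def psum_def)
qed

lemma partitions_of_iff:
  "a \<in> partitions_of n \<longleftrightarrow> length a = n \<and> psum a n = n \<and> (\<forall>i. Suc i < n \<longrightarrow> a ! Suc i \<le> a ! i)"
proof -
  have "sorted_wrt (\<ge>) a \<longleftrightarrow> (\<forall>i. Suc i < length a \<longrightarrow> a ! i \<ge> a ! Suc i)"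
    by (rule sorted_wrt_iff_nth_Suc_transp) (rule transpI, simp)
  moreover have "sum_list a = psum a (length a)"
    by (simp add: psum_def sum_list_sum_nth atLeast0LessThan)
  ultimately show ?thesis by (auto simp: partitions_of_def)
qed

section \<open>Concavity estimates for partial sums\<close>

lemma nth_partition_antimono:
  assumes "a \<in> partitions_of n" "i \<le> j" "j < n"
  shows "a ! j \<le> a ! i"
  using assms(2,3)
proof (induction j rule: dec_induct)
  case (step k)
  with assms(1) show ?case by (fastforce simp: partitions_of_iff intro: order_trans)
qed simp

lemma psum_total: "a \<in> partitions_of n \<Longrightarrow> psum a n = n"
  by (simp add: partitions_of_iff)

lemma psum_le: "a \<in> partitions_of n \<Longrightarrow> j \<le> n \<Longrightarrow> psum a j \<le> n"
  using psum_mono[of j n a] by (simp add: psum_total)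

text \<open>Concavity: from \<open>j\<close> on, the partial sums stay below the line of slope
  \<open>a ! j\<close>.\<close>

lemma psum_add_le:
  assumes "a \<in> partitions_of n" "j + t \<le> n"
  shows "psum a (j + t) \<le> psum a j + t * a ! j"
  using assms(2)
proof (induction t)
  case (Suc t)
  have "a ! (j + t) \<le> a ! j" using Suc.prems by (intro nth_partition_antimono[OF assms(1)]) auto
  with Suc show ?case by simp
qed simp

lemma psum_le_mult:
  assumes a: "a \<in> partitions_of n" "j \<le> n" and c: "psum a 1 \<le> c"
  shows "psum a j \<le> c * j"
proof -
  have "psum a j \<le> j * a ! 0" using psum_add_le[OF a(1), of 0 j] a(2) by simp
  also have "\<dots> \<le> j * c" using c by (intro mult_le_mono2) simp
  finally show ?thesis by (simp add: mult.commute)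
qed

text \<open>Concavity before \<open>j\<close>: the added parts have indices \<open>i\<close> to
  \<open>i + t - 1\<close>, none beyond \<open>j\<close>, so each is at least
  \<open>a ! j\<close>.\<close>

lemma psum_add_ge:
  assumes "a \<in> partitions_of n" "i + t \<le> Suc j" "j < n"
  shows "psum a i + t * a ! j \<le> psum a (i + t)"
  using assms(2)
proof (induction t)
  case (Suc t)
  have "a ! j \<le> a ! (i + t)"
    using Suc.prems assms(3) by (intro nth_partition_antimono[OF assms(1)]) auto
  with Suc show ?case by simp
qed simp

lemma partition_eqI:
  assumes "a \<in> partitions_of n" "b \<in> partitions_of n" "\<And>j. j \<le> n \<Longrightarrow> psum a j = psum b j"
  shows "a = b"
proof (rule nth_equalityI)
  show "length a = length b" using assms(1,2) by (simp add: partitions_of_iff)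
  fix i assume "i < length a"
  then have "i < n" using assms(1) by (simp add: partitions_of_iff)
  then show "a ! i = b ! i" using assms(3)[of i] assms(3)[of "Suc i"] by simp
qed

definition of_psum :: "nat \<Rightarrow> (nat \<Rightarrow> nat) \<Rightarrow> nat list" where
  "of_psum n s = map (\<lambda>i. s (Suc i) - s i) [0..<n]"

text \<open>Monotonicity keeps the truncated differences exact; concavity makes them weakly
  decreasing.\<close>

lemma
  assumes s: "s 0 = 0" "s n = n" "\<And>i. i < n \<Longrightarrow> s i \<le> s (Suc i)"
    "\<And>i. Suc i < n \<Longrightarrow> s i + s (Suc (Suc i)) \<le> 2 * s (Suc i)"
  shows psum_of_psum: "j \<le> n \<Longrightarrow> psum (of_psum n s) j = s j"
    and of_psum_partition: "of_psum n s \<in> partitions_of n"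
proof -
  show *: "psum (of_psum n s) j = s j" if "j \<le> n" for j
    using that s(3) by (induction j) (auto simp: s(1) of_psum_def)
  have "of_psum n s ! Suc i \<le> of_psum n s ! i" if "Suc i < n" for i
    using that s(4)[OF that] s(3)[of i] s(3)[of "Suc i"] by (simp add: of_psum_def)
  then show "of_psum n s \<in> partitions_of n"
    using *[of n] s(2) by (simp add: partitions_of_iff) (simp add: of_psum_def)
qed

lemma finite_partitions_of: "finite (partitions_of n)"
proof (rule finite_subset)
  show "partitions_of n \<subseteq> {xs. set xs \<subseteq> {..n} \<and> length xs = n}"
    using member_le_sum_list unfolding partitions_of_def by fastforce
qed (simp add: finite_lists_length_eq)

text \<open>A pointwise minimum of concave sequences is concave, so meets can be computed on partial
  sums.\<close>

lemma partition_inf_exists: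
  assumes A: "A \<subseteq> partitions_of n" "A \<noteq> {}"
  obtains c where "c \<in> partitions_of n"
    "\<And>j. j \<le> n \<Longrightarrow> psum c j = Min ((\<lambda>a. psum a j) ` A)"
proof -
  define s where "s j = Min ((\<lambda>a. psum a j) ` A)" for j
  have fin: "finite A" using A finite_partitions_of finite_subset by blast
  have le: "s j \<le> psum a j" if "a \<in> A" for a j
    using that fin by (simp add: s_def)
  have attained: "\<exists>a\<in>A. s j = psum a j" for j
    using Min_in[of "(\<lambda>a. psum a j) ` A"] fin A(2) unfolding s_def by blast
  have "s 0 = 0" "s n = n"
    using attained[of 0] attained[of n] A(1) psum_total by auto
  moreover have "s i \<le> s (Suc i)" for i
  proof -
    obtain a where a: "a \<in> A" "s (Suc i) = psum a (Suc i)" using attained by blast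
    show ?thesis using le[OF a(1), of i] a(2) by simp
  qed
  moreover have "s i + s (Suc (Suc i)) \<le> 2 * s (Suc i)" if i: "Suc i < n" for i
  proof -
    \<comment> \<open>A partition attaining the minimum at the middle index bounds the minima at
      both neighbours from above.\<close>
    obtain a where a: "a \<in> A" "s (Suc i) = psum a (Suc i)" using attained by blast
    have "a ! Suc i \<le> a ! i" using a(1) A(1) i by (auto simp: partitions_of_iff)
    then show ?thesis using le[OF a(1), of i] le[OF a(1), of "Suc (Suc i)"] a(2) by simp
  qed
  ultimately have "of_psum n s \<in> partitions_of n" "\<And>j. j \<le> n \<Longrightarrow> psum (of_psum n s) j = s j"
    by (auto intro: of_psum_partition psum_of_psum)
  then show thesis using that unfolding s_def by blast
qed

section \<open>Hooks and flat partitions\<close>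

text \<open>The cap at \<open>n\<close> stops the ones after \<open>n - a\<close> of them, leaving
  \<open>n - a + 1\<close> nonzero parts. The case \<open>j = 0\<close> is separate because the
  formula would give \<open>a - 1\<close> there.\<close>

definition hook :: "nat \<Rightarrow> nat \<Rightarrow> nat list" where
  "hook n a = of_psum n (\<lambda>j. if j = 0 then 0 else min n (a + j - 1))"

lemma
  assumes "1 \<le> a" "a \<le> n"
  shows psum_hook: "j \<le> n \<Longrightarrow> psum (hook n a) j = (if j = 0 then 0 else min n (a + j - 1))"
    and hook_partition: "hook n a \<in> partitions_of n"
  unfolding hook_def
  by (subst psum_of_psum of_psum_partition | use assms in \<open>auto simp: min_def\<close>)+

text \<open>As many parts \<open>c\<close> as fit, then the remainder: the largest partition with
  all parts at most \<open>c\<close>.\<close>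

definition flat :: "nat \<Rightarrow> nat \<Rightarrow> nat list" where
  "flat n c = of_psum n (\<lambda>j. min n (c * j))"

lemma
  assumes "1 \<le> c"
  shows psum_flat: "j \<le> n \<Longrightarrow> psum (flat n c) j = min n (c * j)"
    and flat_partition: "flat n c \<in> partitions_of n"
proof -
  have "n \<le> c * n" using assms by simp
  moreover have "min n (c * i) + min n (c * Suc (Suc i)) \<le> 2 * min n (c * Suc i)" for i
    by (simp add: min_def algebra_simps)
  moreover have "min n (c * i) \<le> min n (c * Suc i)" for i
    by (simp add: min_def)
  ultimately show "flat n c \<in> partitions_of n"
    and "j \<le> n \<Longrightarrow> psum (flat n c) j = min n (c * j)"
    unfolding flat_def by (intro of_psum_partition psum_of_psum; simp)+
qed

text \<open>The partition \<open>(a - 1, 2, 1, \<dots>, 1)\<close>, which lies strictly between \<open>hook n (a - 1)\<close> and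
  \<open>hook n a\<close>.\<close>

definition knee :: "nat \<Rightarrow> nat \<Rightarrow> nat list" where
  "knee n a = of_psum n (\<lambda>j. if j = 0 then 0 else if j = 1 then a - 1 else min n (a + j - 1))"

text \<open>For \<open>a = 2\<close> the parts would begin with 1, 2 and not decrease; for
  \<open>a = n\<close> the cap would turn the 2 into a 1 and give \<open>hook n (n - 1)\<close>.
  These two values are the exceptional ones later.\<close>

lemma
  assumes "3 \<le> a" "a < n"
  shows psum_knee: "j \<le> n \<Longrightarrow> psum (knee n a) j =
      (if j = 0 then 0 else if j = 1 then a - 1 else min n (a + j - 1))"
    and knee_partition: "knee n a \<in> partitions_of n"
  unfolding knee_def
  by (subst psum_of_psum of_psum_partition | use assms in \<open>auto simp: min_def\<close>)+

text \<open>After the first part, each nonzero part adds at least 1, as in the hook; once a part is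
  zero, the total \<open>n\<close> has been reached.\<close>

lemma hook_dominated_iff:
  assumes a: "1 \<le> a" "a \<le> n" and x: "x \<in> partitions_of n"
  shows "dominated n (hook n a) x \<longleftrightarrow> a \<le> psum x 1"
proof
  assume "dominated n (hook n a) x"
  then show "a \<le> psum x 1"
    using a psum_hook[OF a, of 1] by (auto simp: dominated_iff_psum dest: spec[of _ 1])
next
  assume *: "a \<le> psum x 1"
  have "min n (a + j) \<le> psum x (Suc j)" if "j < n" for j
    using that
  proof (induction j)
    case 0
    then show ?case using * by simp
  next
    case (Suc j)
    show ?case
    proof (cases "x ! Suc j = 0")
      case True
      have "psum x (Suc j + (n - Suc j)) \<le> psum x (Suc j) + (n - Suc j) * x ! Suc j"
        using Suc.prems by (intro psum_add_le[OF x]) simp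
      then show ?thesis using True Suc.prems psum_total[OF x] by simp
    next
      case False
      then show ?thesis using Suc by simp
    qed
  qed
  then have "psum (hook n a) j \<le> psum x j" if "j \<le> n" for j
    using that psum_hook[OF a that] by (cases j) auto
  then show "dominated n (hook n a) x" by (simp add: dominated_iff_psum)
qed

text \<open>The right side says that \<open>x\<close> has more than \<open>n - b\<close> nonzero
  parts. These reserve at least 1 for each index up to \<open>n - b\<close>, which bounds the
  earlier partial sums.\<close>

lemma dominated_hook_iff:
  assumes b: "1 \<le> b" "b < n" and x: "x \<in> partitions_of n"
  shows "dominated n x (hook n b) \<longleftrightarrow> psum x (n - b) < n"
proof
  assume "dominated n x (hook n b)"
  then have "psum x (n - b) \<le> psum (hook n b) (n - b)" by (simp add: dominated_iff_psum)
  then show "psum x (n - b) < n" using b by (simp add: psum_hook)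
next
  assume *: "psum x (n - b) < n"
  \<comment> \<open>Indices start at 0, so this is the part right after the first
    \<open>n - b\<close>. Were it zero, those would already sum to \<open>n\<close>.\<close>
  have pos: "x ! (n - b) \<ge> 1"
  proof (rule ccontr)
    assume "\<not> x ! (n - b) \<ge> 1"
    then have "x ! (n - b) = 0" by simp
    then show False
      using psum_add_le[OF x, of "n - b" b] b * psum_total[OF x] by simp
  qed
  have "psum x j \<le> min n (b + j - 1)" if j: "j \<le> n" "j \<noteq> 0" for j
  proof (cases "j \<le> n - b")
    case True
    have "psum x j + (Suc (n - b) - j) * x ! (n - b) \<le> psum x (j + (Suc (n - b) - j))"
      using b True by (intro psum_add_ge[OF x]) auto
    also have "\<dots> = psum x (Suc (n - b))" using True by simp
    also have "\<dots> \<le> n" using b by (intro psum_le[OF x]) simp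
    finally have "psum x j + (Suc (n - b) - j) * x ! (n - b) \<le> n" .
    moreover have "(Suc (n - b) - j) * 1 \<le> (Suc (n - b) - j) * x ! (n - b)"
      using pos by (intro mult_le_mono2)
    ultimately have "psum x j + (Suc (n - b) - j) \<le> n" by linarith
    then show ?thesis using True b j by simp
  next
    case False
    then show ?thesis using psum_le[OF x j(1)] by simp
  qed
  then show "dominated n x (hook n b)"
    using b by (simp add: dominated_iff_psum psum_hook)
qed

lemma dominated_flat_iff:
  assumes c: "1 \<le> c" "c < n" and x: "x \<in> partitions_of n"
  shows "dominated n x (flat n c) \<longleftrightarrow> psum x 1 \<le> c"
proof
  assume "dominated n x (flat n c)"
  then have "psum x 1 \<le> psum (flat n c) 1" using c by (simp only: dominated_iff_psum)
  then show "psum x 1 \<le> c" using c by (simp add: psum_flat del: psum_Suc)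
next
  assume "psum x 1 \<le> c"
  then show "dominated n x (flat n c)"
    using psum_le[OF x] psum_le_mult[OF x] by (simp add: dominated_iff_psum psum_flat[OF c(1)])
qed

section \<open>The dominance lattice\<close>

lemma carrier_partition_lattice [simp]: "carrier (partition_lattice n) = partitions_of n"
  and le_partition_lattice [simp]: "x \<sqsubseteq>\<^bsub>partition_lattice n\<^esub> y \<longleftrightarrow> dominated n x y"
  and eq_partition_lattice [simp]: "x .=\<^bsub>partition_lattice n\<^esub> y \<longleftrightarrow> x = y"
  by (simp_all add: partition_lattice_def)

lemma dominated_refl [simp]: "dominated n x x"
  by (simp add: dominated_def)

lemma dominated_trans: "dominated n x y \<Longrightarrow> dominated n y z \<Longrightarrow> dominated n x z"
  by (auto simp: dominated_def intro: order_trans)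

lemma dominated_antisym:
  "dominated n x y \<Longrightarrow> dominated n y x \<Longrightarrow> x \<in> partitions_of n \<Longrightarrow> y \<in> partitions_of n \<Longrightarrow> x = y"
  by (rule partition_eqI) (auto simp: dominated_iff_psum intro: order_antisym)

lemma dominated_hook_top:
  assumes "1 \<le> n" "x \<in> partitions_of n"
  shows "dominated n x (hook n n)"
  using assms psum_le[OF assms(2)] by (auto simp: dominated_iff_psum psum_hook)

text \<open>A greatest element, here the one-part partition \<open>hook n n\<close>, and infima of
  nonempty sets suffice for completeness.\<close>

lemma finite_complete_partition_lattice:
  assumes n: "1 \<le> n"
  shows "finite_complete_lattice (partition_lattice n)"
proof -
  let ?L = "partition_lattice n"
  interpret partial_order ?L
    by unfold_locales
      (auto intro: dominated_antisym dominated_trans simp: fun_eq_iff)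
  interpret complete_lattice ?L
  proof (rule complete_lattice_criterion1)
    have "greatest ?L (hook n n) (carrier ?L)"
      using n dominated_hook_top hook_partition by (simp add: greatest_def)
    then show "\<exists>g. greatest ?L g (carrier ?L)" ..
    fix A assume A: "A \<subseteq> carrier ?L" "A \<noteq> {}"
    then obtain c where c: "c \<in> partitions_of n"
      "\<And>j. j \<le> n \<Longrightarrow> psum c j = Min ((\<lambda>a. psum a j) ` A)"
      using partition_inf_exists[of A n] by auto
    have fin: "finite A" using A finite_partitions_of finite_subset by simp blast
    have "greatest ?L c (Lower ?L A)"
    proof (rule greatest_LowerI)
      show "c \<sqsubseteq>\<^bsub>?L\<^esub> x" if "x \<in> A" for x
        using that fin by (simp add: dominated_iff_psum c(2))
      show "y \<sqsubseteq>\<^bsub>?L\<^esub> c" if "y \<in> Lower ?L A" for y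
      proof -
        have "dominated n y x" if "x \<in> A" for x
          using \<open>y \<in> Lower ?L A\<close> that A(1) by (auto simp: Lower_def)
        then show ?thesis
          using fin A(2) by (simp add: dominated_iff_psum c(2))
      qed
    qed (use A(1) c(1) in auto)
    then show "\<exists>i. greatest ?L i (Lower ?L A)" ..
  qed
  show ?thesis
    by unfold_locales (simp add: finite_partitions_of)
qed

lemma hook_inj_on: "inj_on (hook n) {1..n}"
proof (rule inj_onI)
  fix a b assume "a \<in> {1..n}" "b \<in> {1..n}" "hook n a = hook n b"
  then show "a = b" using psum_hook[of a n 1] psum_hook[of b n 1] by (simp del: psum_Suc)
qed

section \<open>Prime pairs of the dominance lattice\<close>

lemma prime_pair_partition_iff:
  "prime_pair (partition_lattice n) g m \<longleftrightarrow> g \<in> partitions_of n \<and> m \<in> partitions_of n \<and>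
     (\<forall>x\<in>partitions_of n. dominated n g x \<longleftrightarrow> \<not> dominated n x m)"
  by (simp add: prime_pair_def)

text \<open>\<open>m\<close> is the greatest element not above \<open>g\<close>. With the dual
  lemma, this makes both projections injective on prime pairs, so that they can be counted by either
  component.\<close>

lemma prime_pair_unique_attribute:
  assumes "prime_pair (partition_lattice n) g m" "prime_pair (partition_lattice n) g m'"
  shows "m = m'"
  using assms dominated_antisym[of n m m'] unfolding prime_pair_partition_iff
  by (metis dominated_refl)

lemma prime_pair_unique_object:
  assumes "prime_pair (partition_lattice n) g m" "prime_pair (partition_lattice n) g' m"
  shows "g = g'"
  using assms dominated_antisym[of n g g'] unfolding prime_pair_partition_iff
  by (metis dominated_refl)

lemma prime_pair_hook_flat:
  assumes "2 \<le> a" "a \<le> n"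
  shows "prime_pair (partition_lattice n) (hook n a) (flat n (a - 1))"
  using assms hook_partition[of a n] flat_partition[of "a - 1" n]
  by (auto simp: prime_pair_partition_iff hook_dominated_iff dominated_flat_iff simp del: psum_Suc)

text \<open>\<open>g\<close> is the meet of all partitions with at most \<open>n - b\<close> nonzero
  parts. It is one of them, since all have partial sum \<open>n\<close> at \<open>n - b\<close> and
  meets take minima of partial sums.\<close>

lemma prime_pair_hook_exists:
  assumes b: "1 \<le> b" "b < n"
  shows "\<exists>g. prime_pair (partition_lattice n) g (hook n b)"
proof -
  let ?A = "{x \<in> partitions_of n. psum x (n - b) = n}"
  have "hook n n \<in> ?A" using b by (simp add: hook_partition psum_hook)
  then obtain g where g: "g \<in> partitions_of n"
    "\<And>j. j \<le> n \<Longrightarrow> psum g j = Min ((\<lambda>a. psum a j) ` ?A)"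
    using partition_inf_exists[of ?A n] by blast
  have fin: "finite ?A" using finite_partitions_of by simp
  have "(\<lambda>a. psum a (n - b)) ` ?A = {n}" using \<open>hook n n \<in> ?A\<close> by force
  then have gn: "psum g (n - b) = n" using g(2)[of "n - b"] by simp
  have "dominated n g x \<longleftrightarrow> \<not> psum x (n - b) < n" if x: "x \<in> partitions_of n" for x
  proof
    assume "dominated n g x"
    then have "psum g (n - b) \<le> psum x (n - b)" by (simp add: dominated_iff_psum)
    then show "\<not> psum x (n - b) < n" using gn by simp
  next
    assume "\<not> psum x (n - b) < n"
    then have "x \<in> ?A" using x psum_le[OF x, of "n - b"] by simp
    then show "dominated n g x" using fin by (simp add: dominated_iff_psum g(2))
  qed
  then have "prime_pair (partition_lattice n) g (hook n b)"
    using g(1) b hook_partition[of b n] by (simp add: prime_pair_partition_iff dominated_hook_iff)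
  then show ?thesis ..
qed

text \<open>The claim becomes: first part at least \<open>a\<close> iff at most
  \<open>n - a + 1\<close> nonzero parts. For \<open>3 <= a < n\<close> the partition
  \<open>knee n a\<close> has that many parts but first part \<open>a - 1\<close>. For
  \<open>a = 2\<close> both conditions exclude only (1, ..., 1); for \<open>a = n\<close> both
  single out the partition with one part.\<close>

lemma prime_pair_consecutive_hooks_iff:
  assumes a: "2 \<le> a" "a \<le> n"
  shows "prime_pair (partition_lattice n) (hook n a) (hook n (a - 1)) \<longleftrightarrow> a = 2 \<or> a = n"
    (is "?P \<longleftrightarrow> _")
proof -
  have iff: "?P \<longleftrightarrow> (\<forall>x\<in>partitions_of n. a \<le> psum x 1 \<longleftrightarrow> psum x (n - (a - 1)) = n)"
  proof -
    have "(a \<le> psum x 1 \<longleftrightarrow> \<not> psum x (n - (a - 1)) < n) \<longleftrightarrow>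
        (a \<le> psum x 1 \<longleftrightarrow> psum x (n - (a - 1)) = n)" if "x \<in> partitions_of n" for x
      using psum_le[OF that, of "n - (a - 1)"] by (simp del: psum_Suc)
    then show ?thesis
      using a hook_partition[of a n] hook_partition[of "a - 1" n]
      by (simp add: prime_pair_partition_iff hook_dominated_iff dominated_hook_iff del: psum_Suc)
  qed
  show ?thesis
  proof
    assume ?P
    show "a = 2 \<or> a = n"
    proof (rule ccontr)
      assume "\<not> (a = 2 \<or> a = n)"
      then have a': "3 \<le> a" "a < n" using a by auto
      then have "psum (knee n a) 1 = a - 1" "psum (knee n a) (n - (a - 1)) = n"
        using psum_knee[OF a', of 1] psum_knee[OF a', of "n - (a - 1)"]
        by (auto simp del: psum_Suc)
      then show False using \<open>?P\<close> iff knee_partition[OF a'] a' by fastforce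
    qed
  next
    assume "a = 2 \<or> a = n"
    moreover have "2 \<le> psum x 1 \<longleftrightarrow> psum x (n - 1) = n" if x: "x \<in> partitions_of n" "a = 2" for x
    proof
      assume "2 \<le> psum x 1"
      then have "dominated n (hook n 2) x" using hook_dominated_iff[of 2 n x] a x by simp
      then have "psum (hook n 2) (n - 1) \<le> psum x (n - 1)" by (simp add: dominated_iff_psum)
      then show "psum x (n - 1) = n"
        using psum_hook[of 2 n "n - 1"] a x psum_le[OF x(1), of "n - 1"] by simp
    next
      assume *: "psum x (n - 1) = n"
      show "2 \<le> psum x 1"
      proof (rule ccontr)
        assume "\<not> 2 \<le> psum x 1"
        then show False using psum_le_mult[OF x(1), of "n - 1" 1] * a by simp
      qed
    qed
    moreover have "n \<le> psum x 1 \<longleftrightarrow> psum x (n - (n - 1)) = n" if "x \<in> partitions_of n" for x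
      using psum_le[OF that, of 1] a by (auto simp del: psum_Suc)
    ultimately show ?P using iff by (auto simp del: psum_Suc)
  qed
qed

text \<open>Let \<open>a\<close> be minimal with \<open>g \<le> hook n a\<close>, so that \<open>hook n (a - 1) \<le> m\<close>. If \<open>g \<noteq> hook n a\<close> and
  \<open>m \<noteq> hook n (a - 1)\<close>, then \<open>g \<le> knee n a \<le> m\<close>, which is absurd.\<close>

lemma prime_pair_hook_cases:
  assumes n: "2 \<le> n" and pp: "prime_pair (partition_lattice n) g m"
  shows "(\<exists>a\<in>{2..n}. g = hook n a) \<or> (\<exists>b\<in>{1..n-1}. m = hook n b)"
proof -
  have g: "g \<in> partitions_of n" and m: "m \<in> partitions_of n"
    and gm: "\<And>x. x \<in> partitions_of n \<Longrightarrow> dominated n g x \<longleftrightarrow> \<not> dominated n x m"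
    using pp by (auto simp: prime_pair_partition_iff)
  define a where "a = (LEAST a. 1 \<le> a \<and> dominated n g (hook n a))"
  have "1 \<le> n \<and> dominated n g (hook n n)" using n g dominated_hook_top by simp
  then have a: "1 \<le> a" "a \<le> n" "dominated n g (hook n a)"
    unfolding a_def by (metis (mono_tags, lifting) LeastI Least_le)+
  have not_less: "\<not> dominated n g (hook n c)" if "1 \<le> c" "c < a" for c
    using that not_less_Least[of c] unfolding a_def by blast
  \<comment> \<open>\<open>hook n 1\<close> is the least partition, so it lies below
    \<open>m\<close> and cannot lie above \<open>g\<close>; this excludes
    \<open>a = 1\<close>.\<close>
  have "dominated n (hook n 1) m"
  proof -
    have "m ! 0 \<noteq> 0"
      using psum_add_le[OF m, of 0 n] psum_total[OF m] n by auto
    then show ?thesis using hook_dominated_iff[of 1 n m] m n by simp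
  qed
  then have "a \<noteq> 1" using gm[of "hook n 1"] hook_partition[of 1 n] a n by auto
  then have a2: "2 \<le> a" using a by simp
  have hm: "dominated n (hook n (a - 1)) m"
    using gm[of "hook n (a - 1)"] not_less[of "a - 1"] hook_partition[of "a - 1" n] a a2 by simp
  show ?thesis
  proof (rule ccontr)
    assume neg: "\<not> ?thesis"
    then have "g \<noteq> hook n a" "m \<noteq> hook n (a - 1)" using a a2 by force+
    then have "\<not> dominated n (hook n a) g" "\<not> dominated n m (hook n (a - 1))"
      using a hm g m hook_partition[of a n] hook_partition[of "a - 1" n] a2 dominated_antisym by auto
    \<comment> \<open>In terms of parts: the first part of \<open>g\<close> is below
      \<open>a\<close>, and \<open>m\<close> has at most \<open>n - a + 1\<close> nonzero
      parts.\<close>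
    then have "\<not> a \<le> psum g 1" "\<not> psum m (n - (a - 1)) < n"
      using hook_dominated_iff[of a n g] dominated_hook_iff[of "a - 1" n m] a a2 g m by auto
    then have g1: "psum g 1 \<le> a - 1" and mn: "psum m (n - (a - 1)) = n"
      using psum_le[OF m, of "n - (a - 1)"] by linarith+
    have m1: "a - 1 \<le> psum m 1" using hook_dominated_iff[of "a - 1" n m] hm a a2 m by simp
    \<comment> \<open>In both extreme cases the bound on the first part of \<open>g\<close> already
      gives \<open>g\<close> below \<open>hook n (a - 1)\<close>, against the minimality of
      \<open>a\<close>.\<close>
    have "a \<noteq> n"
    proof
      assume "a = n"
      then have "dominated n g (hook n (a - 1))"
        using g1 a2 dominated_hook_iff[of "a - 1" n g] g by (simp del: psum_Suc)
      moreover have "1 \<le> a - 1" "a - 1 < a" using a2 by auto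
      ultimately show False using not_less by blast
    qed
    moreover have "a \<noteq> 2"
    proof
      assume [simp]: "a = 2"
      have "psum g j \<le> j" if "j \<le> n" for j
        using psum_le_mult[OF g that, of 1] g1 by simp
      then have "dominated n g (hook n 1)"
        using n by (simp add: dominated_iff_psum psum_hook)
      then show False using not_less[of 1] by simp
    qed
    ultimately have a': "3 \<le> a" "a < n" using a a2 by auto
    \<comment> \<open>\<open>knee n a\<close> differs from \<open>hook n a\<close> only in its first
      partial sum, where \<open>g1\<close> applies.\<close>
    have "psum g j \<le> psum (knee n a) j" if "j \<le> n" for j
    proof -
      have "psum g j \<le> psum (hook n a) j" using a(3) that by (simp add: dominated_iff_psum)
      then show ?thesis
        using that g1 a by (auto simp: psum_hook psum_knee[OF a'] split: if_splits)
    qed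
    then have "dominated n g (knee n a)" by (simp add: dominated_iff_psum)
    moreover have "psum (knee n a) j \<le> psum m j" if j: "j \<le> n" for j
    proof -
      have "min n (a + j - 1) \<le> psum m j" if "2 \<le> j"
      proof (cases "n - (a - 1) \<le> j")
        case True
        then show ?thesis using psum_mono[OF True, of m] mn by simp
      next
        case False
        \<comment> \<open>\<open>t\<close> counts the parts of \<open>m\<close> after the first
          \<open>j\<close> that may still be nonzero. If \<open>m ! j\<close> is at least 2, so are
          all earlier parts, and the first \<open>j\<close> already sum to enough. Otherwise the
          last \<open>t\<close> parts contribute at most \<open>t\<close>, leaving
          \<open>n - t = a + j - 1\<close> for the first \<open>j\<close>.\<close>
        define t where "t = n - (a - 1) - j"
        have t: "j + t = n - (a - 1)" "1 \<le> t" using False by (auto simp: t_def)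
        have le: "n \<le> psum m j + t * m ! j"
          using psum_add_le[OF m, of j t] t mn by simp
        show ?thesis
        proof (cases "2 \<le> m ! j")
          case True
          have j1: "1 + (j - 1) = j" using \<open>2 \<le> j\<close> by simp
          have "psum m 1 + (j - 1) * m ! j \<le> psum m j"
            by (rule psum_add_ge[OF m, of 1 "j - 1" j, unfolded j1]) (use False a2 in auto)
          moreover have "(j - 1) * 2 \<le> (j - 1) * m ! j" using True by (rule mult_le_mono2)
          ultimately have "a - 1 + (j - 1) * 2 \<le> psum m j" using m1 by linarith
          then show ?thesis using \<open>2 \<le> j\<close> by simp
        next
          case mj: False
          have "t * m ! j \<le> t * 1" using mj by (intro mult_le_mono2) simp
          then have "n \<le> psum m j + t" using le by linarith
          then show ?thesis using t a a2 by simp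
        qed
      qed
      then show ?thesis using j m1 by (auto simp: psum_knee[OF a'])
    qed
    then have "dominated n (knee n a) m" by (simp add: dominated_iff_psum)
    ultimately show False using gm[OF knee_partition[OF a']] by simp
  qed
qed

text \<open>Inclusion-exclusion: the pairs with a hook as object and those with a hook as attribute
  number \<open>n - 1\<close> each and share two.\<close>

lemma card_prime_pairs:
  assumes n: "3 \<le> n"
  shows "card {(g, m). prime_pair (partition_lattice n) g m} = 2 * n - 4"
proof -
  define P where "P = {(g, m). prime_pair (partition_lattice n) g m}"
  define A where "A = {p \<in> P. fst p \<in> hook n ` {2..n}}"
  define B where "B = {p \<in> P. snd p \<in> hook n ` {1..n-1}}"
  have inj: "inj_on fst P" "inj_on snd P"
    by (auto simp: inj_on_def P_def dest: prime_pair_unique_attribute prime_pair_unique_object)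
  have "fst ` A = hook n ` {2..n}"
    using prime_pair_hook_flat by (force simp: A_def P_def)
  then have "bij_betw fst A (hook n ` {2..n})"
    using inj(1) by (auto simp: bij_betw_def A_def intro: inj_on_subset)
  moreover have "inj_on (hook n) {2..n}"
    by (rule inj_on_subset[OF hook_inj_on]) auto
  ultimately have A: "finite A" "card A = n - 1"
    by (auto simp: bij_betw_finite bij_betw_same_card card_image)
  have "snd ` B = hook n ` {1..n-1}"
  proof -
    have "hook n b \<in> snd ` B" if "b \<in> {1..n-1}" for b
    proof -
      have "1 \<le> b" "b < n" using that n by auto
      from prime_pair_hook_exists[OF this] obtain g
        where "prime_pair (partition_lattice n) g (hook n b)" ..
      then have "(g, hook n b) \<in> B" using that by (simp add: B_def P_def)
      then show ?thesis by force
    qed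
    then show ?thesis by (auto simp: B_def)
  qed
  then have "bij_betw snd B (hook n ` {1..n-1})"
    using inj(2) by (auto simp: bij_betw_def B_def intro: inj_on_subset)
  moreover have "inj_on (hook n) {1..n-1}"
    by (rule inj_on_subset[OF hook_inj_on]) auto
  ultimately have B: "finite B" "card B = n - 1"
    by (auto simp: bij_betw_finite bij_betw_same_card card_image)
  have "A \<inter> B = {(hook n 2, hook n 1), (hook n n, hook n (n - 1))}"
  proof (intro equalityI subsetI)
    fix p assume p: "p \<in> A \<inter> B"
    then obtain a b where ab: "p = (hook n a, hook n b)" "2 \<le> a" "a \<le> n" "1 \<le> b" "b \<le> n - 1"
      by (cases p) (auto simp: A_def B_def)
    then have pp: "prime_pair (partition_lattice n) (hook n a) (hook n b)"
      using p by (simp add: A_def P_def)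
    \<comment> \<open>Testing the prime pair on the hooks \<open>hook n c\<close> shows that
      \<open>a <= c\<close> iff not \<open>c <= b\<close>. The choices \<open>c = b\<close> and
      \<open>c = a - 1\<close> then give \<open>b = a - 1\<close>.\<close>
    have a_le: "a \<le> c \<longleftrightarrow> \<not> dominated n (hook n c) (hook n b)" if "1 \<le> c" "c \<le> n" for c
      using pp ab(2,3) that hook_partition[OF that] hook_dominated_iff[of a n "hook n c"]
        psum_hook[OF that, of 1] by (simp add: prime_pair_partition_iff del: psum_Suc)
    have le_b: "dominated n (hook n c) (hook n b) \<longleftrightarrow> c \<le> b" if "1 \<le> c" "c \<le> n" for c
      using that ab(4,5) n hook_partition[of b n] hook_dominated_iff[of c n "hook n b"]
        psum_hook[of b n 1] by (simp del: psum_Suc)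
    have "\<not> a \<le> b" using a_le[of b] ab n by simp
    moreover have "1 \<le> a - 1" "a - 1 \<le> n" using ab by auto
    then have "a - 1 \<le> b" using a_le[of "a - 1"] le_b[of "a - 1"] by auto
    ultimately have "b = a - 1" by simp
    then show "p \<in> {(hook n 2, hook n 1), (hook n n, hook n (n - 1))}"
      using pp ab prime_pair_consecutive_hooks_iff[of a n] by auto
  next
    fix p assume "p \<in> {(hook n 2, hook n 1), (hook n n, hook n (n - 1))}"
    then show "p \<in> A \<inter> B"
      using prime_pair_consecutive_hooks_iff[of 2 n] prime_pair_consecutive_hooks_iff[of n n] n
      by (auto simp: A_def B_def P_def)
  qed
  moreover have "hook n 2 \<noteq> hook n n"
    using inj_onD[OF hook_inj_on[of n], of 2 n] n by auto
  ultimately have "card (A \<inter> B) = 2" by simp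
  moreover have "P = A \<union> B"
    using prime_pair_hook_cases[of n] n by (force simp: A_def B_def P_def)
  ultimately show ?thesis
    using card_Un_Int[OF A(1) B(1)] A(2) B(2) n by (simp flip: P_def)
qed

theorem proposition6p3:
  fixes n :: nat
  assumes "n \<ge> 3"
  shows "card {S. one_generated (partition_lattice n) S \<and> one_by_one S} = 2 * n - 4"
  using finite_complete_lattice.card_one_generated_one_by_one[OF finite_complete_partition_lattice]
    card_prime_pairs[OF assms] assms by simp

end
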